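(* Consider, for $d\ge 2$, the equation satisfied by the polynomials $N^{(d)}$: $$N^{(d)}_{(200)^3}=\frac{18}{E^{(d)}}\sum_{\substack{d_1+d_2=d\\ d_1,d_2>0\\ s,t}}\Big\{d_1d_2\big(N^{(d_1)}_{200}E^{(d_1)}\big)_s\,\mathcal T_{s^*t^*}\,\big(N^{(d_2)}_{200}E^{(d_2)}\big)_t-d_1^2\big(N^{(d_1)}E^{(d_1)}\big)_s\,\mathcal T_{s^*t^*}\,\big(N^{(d_2)}_{200,200}E^{(d_2)}\big)_t\Big\}.$$ Given $N^{(1)}$, this equation uniquely determines $N^{(d)}_{(200)^{3d-3}}=\partial^{3d-3}N^{(d)}/\partial y_{200}^{3d-3}$ for all $d>0$.
   Context: Work over $\mathbb C$. **Semple bundle.** $S_1=\mathbf P T(\mathbf P^2)$, $f_1:S_1\to\mathbf P^2$; the focal plane at $x\in S_1$ is the preimage under $df_1$ of the line in $T_{f_1(x)}\mathbf P^2$ represented by $x$; these form a rank 2 subbundle $\mathcal F_1\subset T(S_1)$; $S_2=\mathbf P\mathcal F_1\subset\mathbf PT(S_1)$. $I=\mathbf PT(S_1/\mathbf P^2)$ is the divisor at infinity, $Z=\mathbf PT(S_1/\check{\mathbf P}^2)$ the dual one; $h,\check h$ are pullbacks of the hyperplane classes of $\mathbf P^2,\check{\mathbf P}^2$; $i=[I]$, $z=[Z]$. **Bases.** The $z$-basis of $A^*(S_2)$ is $Y_{abc}=h^a\check h^bz^c$ and the $i$-basis is $Y^*_{abc}=h^a\check h^bi^c$, with $(a,b)\in\{(0,0),(1,0),(2,0),(0,1),(0,2),(2,1)\}$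 and $c\in\{0,1\}$. The dual of $Y_k$ under the intersection pairing is $Y^*_{k^*}$, where $k+k^*=211$ or $121$. Write $\gamma=\sum y_kY_k$, and let $y^*_l$ be the coefficients of $\delta=\sum y_l^*Y_l^*$. **Quantum potential.** The second-order strict lift of a nonconstant $\mu:\mathbf P^1\to\mathbf P^2$ is obtained by applying twice the operation $x\mapsto$ direction of the differential at $x$ (extended over singular points). $\lambda_d$ is the class of the second-order strict lift of a degree $d$ immersion; $\overline M^2_n(\mathbf P^2,d)$ is the closure of the image of the rational lifting map $\overline M_n(\mathbf P^2,d)\dashrightarrow\overline M_n(S_2,\lambda_d)$ (genus 0 stable maps); $\langle\prod\gamma_k\rangle_d=\int\prod e_k^*(\gamma_k)\cap[\overline M_n^2(\mathbf P^2,d)]$. For $\mathbf a=(a_{200},a_{020},a_{210},a_{101},a_{201},a_{011},a_{021},a_{211})$ a vector of nonnegative integers, put $\|\mathbf a\|=\sum_k(|k|-1)a_k$ ($|k|$ the sum of the entries of $k$), $\mathbf y^{\mathbf a}=\prod y_k^{a_k}$, $\mathbf a!=\prod a_k!$, and $N_d(\mathbf a)=\langle\prod_kY_k^{a_k}\rangle_d$ (i.e. $a_k$ of the insertions equal $Y_k$). Then $$N^{(d)}=\sum_{\|\mathbf a\|=3d-1}N_d(\mathbf a)\frac{\mathbf y^{\mathbf a}}{\mathbf a!},\qquad E^{(d)}=\exp(dy_{100}+(2d-2)y_{010}+(3d-6)y_{001}).$$ **The potential $\mathcal T$.** $\overline R_{n,2}(1,2)$ is the stack of $(n+2)$-marked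 stable maps to $S_2$ whose general member is a double cover $\mathbf P^1\to$ (lift to $S_2$ of a fiber of $S_1\to\mathbf P^2$) with the last two markings at its ramification points. $\overline R_{n,2}(2,3)$ is the stack whose general member is an $(n+2)$-marked triple cover of a fiber of $S_2\to S_1$ ramified only at the last two markings. $\overline T_n$ is the stack of $(n+2)$-marked maps with three-twig source (a chain): the central twig is a map of the first kind with its ramification points at the two attachment points; the peripheral twigs are maps of the second kind, each with one ramification point at the attachment point and the other at marking $n+1$, respectively $n+2$; the first $n$ markings are distributed arbitrarily. Then $$\mathcal T=\sum_{n\ge0}\frac1{2\,n!}\int e_1^*(\gamma)\cup\cdots\cup e_n^*(\gamma)\cup e_{n+1}^*(\delta)\cup e_{n+2}^*(\delta)\cap[\overline T_n],$$ using fundamental classes of stacks. **Derivatives.** Subscripts $k$ denote $\partial/\partial y_k$, subscripts $k^*$ denote $\partial/\partial y^*_{k^*}$; e.g. $N_{(200)^3}=\partial^3N/\partial y_{200}^3$, $N_{200,200}=\partial^2N/\partial y_{200}^2$. The sums over $s$ and $t$ run over all twelve subscripts of the $z$-basis. *)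

theory Defs
  imports "HOL-Analysis.Analysis" "HOL-Computational_Algebra.Polynomial"
begin

section \<open>Formal power series in finitely many variables\<close>

text \<open>A series in the variables \<open>'v\<close> is its coefficient function on exponent vectors.\<close>

typedef 'v series = "UNIV :: (('v \<Rightarrow> nat) \<Rightarrow> real) set"
  morphisms coef Series by simp

setup_lifting type_definition_series

lemma series_eqI: "(\<And>\<mu>. coef f \<mu> = coef g \<mu>) \<Longrightarrow> f = g"
  by (metis coef_inject ext)

lemma coef_Series [simp]: "coef (Series c) = c"
  by (simp add: Series_inverse)

definition below :: "('v \<Rightarrow> nat) \<Rightarrow> ('v \<Rightarrow> nat) set" where
  "below \<mu> = {\<alpha>. \<forall>v. \<alpha> v \<le> \<mu> v}"

lemma finite_below [simp]: "finite (below (\<mu> :: 'v::finite \<Rightarrow> nat))"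
proof -
  have "below \<mu> = PiE UNIV (\<lambda>v. {..\<mu> v})"
    by (auto simp: below_def PiE_def Pi_def)
  then show ?thesis by (simp add: finite_PiE)
qed

instantiation series :: (finite) comm_ring_1
begin

lift_definition zero_series :: "'a series" is "\<lambda>_. 0" .
lift_definition one_series :: "'a series" is "\<lambda>\<mu>. if \<mu> = (\<lambda>_. 0) then 1 else 0" .
lift_definition plus_series :: "'a series \<Rightarrow> 'a series \<Rightarrow> 'a series" is "\<lambda>f g \<mu>. f \<mu> + g \<mu>" .
lift_definition minus_series :: "'a series \<Rightarrow> 'a series \<Rightarrow> 'a series" is "\<lambda>f g \<mu>. f \<mu> - g \<mu>" .
lift_definition uminus_series :: "'a series \<Rightarrow> 'a series" is "\<lambda>f \<mu>. - f \<mu>" .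
lift_definition times_series :: "'a series \<Rightarrow> 'a series \<Rightarrow> 'a series"
  is "\<lambda>f g \<mu>. \<Sum>\<alpha>\<in>below \<mu>. f \<alpha> * g (\<lambda>v. \<mu> v - \<alpha> v)" .

instance
proof
  fix a b c :: "'a series"
  show "a + b + c = a + (b + c)" by transfer (simp add: add.assoc)
  show "a + b = b + a" by transfer (simp add: add.commute)
  show "0 + a = a" by transfer simp
  show "- a + a = 0" by transfer simp
  show "a - b = a + - b" by transfer simp
  show "(a + b) * c = a * c + b * c"
    by transfer (simp add: distrib_right sum.distrib)
  show "(0::'a series) \<noteq> 1"
    by transfer (metis zero_neq_one)
  show "a * b = b * a"
  proof (transfer, rule ext)
    fix a b :: "('a \<Rightarrow> nat) \<Rightarrow> real" and \<mu> :: "'a \<Rightarrow> nat"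
    show "(\<Sum>\<alpha>\<in>below \<mu>. a \<alpha> * b (\<lambda>v. \<mu> v - \<alpha> v)) = (\<Sum>\<alpha>\<in>below \<mu>. b \<alpha> * a (\<lambda>v. \<mu> v - \<alpha> v))"
      by (rule sum.reindex_bij_witness[where i = "\<lambda>\<alpha> v. \<mu> v - \<alpha> v" and j = "\<lambda>\<alpha> v. \<mu> v - \<alpha> v"])
        (auto simp: below_def)
  qed
  show "1 * a = a"
  proof (transfer, rule ext)
    fix a :: "('a \<Rightarrow> nat) \<Rightarrow> real" and \<mu> :: "'a \<Rightarrow> nat"
    have "(\<Sum>\<alpha>\<in>below \<mu>. (if \<alpha> = (\<lambda>_. 0) then 1 else 0) * a (\<lambda>v. \<mu> v - \<alpha> v))
        = (\<Sum>\<alpha>\<in>below \<mu>. if \<alpha> = (\<lambda>_. 0) then a \<mu> else 0)"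
      by (rule sum.cong) auto
    also have "\<dots> = a \<mu>" by (simp add: below_def[of \<mu>] sum.delta finite_below[unfolded below_def])
    finally show "(\<Sum>\<alpha>\<in>below \<mu>. (if \<alpha> = (\<lambda>_. 0) then 1 else 0) * a (\<lambda>v. \<mu> v - \<alpha> v)) = a \<mu>" .
  qed
  show "a * b * c = a * (b * c)"
  proof (transfer, rule ext)
    fix a b c :: "('a \<Rightarrow> nat) \<Rightarrow> real" and \<mu> :: "'a \<Rightarrow> nat"
    have "(\<Sum>\<alpha>\<in>below \<mu>. (\<Sum>\<beta>\<in>below \<alpha>. a \<beta> * b (\<lambda>v. \<alpha> v - \<beta> v)) * c (\<lambda>v. \<mu> v - \<alpha> v))
       = (\<Sum>(\<alpha>,\<beta>)\<in>(SIGMA \<alpha>:below \<mu>. below \<alpha>). a \<beta> * b (\<lambda>v. \<alpha> v - \<beta> v) * c (\<lambda>v. \<mu> v - \<alpha> v))"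
      by (simp add: sum_distrib_right sum.Sigma)
    also have "\<dots> = (\<Sum>(\<beta>,\<gamma>)\<in>(SIGMA \<beta>:below \<mu>. below (\<lambda>v. \<mu> v - \<beta> v)).
        a \<beta> * (b \<gamma> * c (\<lambda>v. \<mu> v - \<beta> v - \<gamma> v)))"
    proof (rule sum.reindex_bij_witness[where i = "\<lambda>(\<beta>,\<gamma>). (\<lambda>v. \<beta> v + \<gamma> v, \<beta>)"
            and j = "\<lambda>(\<alpha>,\<beta>). (\<beta>, \<lambda>v. \<alpha> v - \<beta> v)"], goal_cases)
      case (1 x)
      then show ?case by (auto simp: below_def fun_eq_iff)
    next
      case (2 x)
      then show ?case by (auto simp: below_def intro: le_trans diff_le_mono)
    next
      case (3 x)
      then show ?case by (auto simp: below_def fun_eq_iff)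
    next
      case (4 x)
      obtain \<beta> \<gamma> where x: "x = (\<beta>, \<gamma>)" by (cases x)
      with 4 have le: "\<beta> v \<le> \<mu> v" "\<gamma> v \<le> \<mu> v - \<beta> v" for v
        by (auto simp: below_def)
      have "\<beta> v + \<gamma> v \<le> \<mu> v" for v
        using le[of v] by linarith
      with x show ?case by (simp add: below_def)
    next
      case (5 x)
      obtain \<alpha> \<beta> where x: "x = (\<alpha>, \<beta>)" by (cases x)
      with 5 have "(\<lambda>v. \<mu> v - \<beta> v - (\<alpha> v - \<beta> v)) = (\<lambda>v. \<mu> v - \<alpha> v)"
        by (auto simp: below_def)
      with x show ?case by (simp add: mult.assoc)
    qed
    also have "\<dots> = (\<Sum>\<beta>\<in>below \<mu>. a \<beta> * (\<Sum>\<gamma>\<in>below (\<lambda>v. \<mu> v - \<beta> v). b \<gamma> * c (\<lambda>v. \<mu> v - \<beta> v - \<gamma> v)))"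
      by (simp add: sum_distrib_left sum.Sigma)
    finally show "(\<Sum>\<alpha>\<in>below \<mu>. (\<Sum>\<beta>\<in>below \<alpha>. a \<beta> * b (\<lambda>v. \<alpha> v - \<beta> v)) * c (\<lambda>v. \<mu> v - \<alpha> v))
       = (\<Sum>\<beta>\<in>below \<mu>. a \<beta> * (\<Sum>\<gamma>\<in>below (\<lambda>v. \<mu> v - \<beta> v). b \<gamma> * c (\<lambda>v. \<mu> v - \<beta> v - \<gamma> v)))" .
  qed
qed

end

definition pd :: "'v \<Rightarrow> 'v series \<Rightarrow> 'v series" where
  "pd v f = Series (\<lambda>\<mu>. real (\<mu> v + 1) * coef f (\<mu>(v := \<mu> v + 1)))"

text \<open>\<open>exp_lin c\<close> is the formal exponential of the linear form with coefficients \<open>c\<close>.\<close>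

definition exp_lin :: "('v::finite \<Rightarrow> real) \<Rightarrow> 'v series" where
  "exp_lin c = Series (\<lambda>\<mu>. \<Prod>v\<in>UNIV. c v ^ \<mu> v / fact (\<mu> v))"

lemma exp_lin_mult_minus: "exp_lin c * exp_lin (\<lambda>v. - c v) = (1 :: 'v::finite series)"
proof (rule series_eqI)
  fix \<mu> :: "'v \<Rightarrow> nat"
  have b: "below \<mu> = PiE UNIV (\<lambda>v. {..\<mu> v})"
    by (auto simp: below_def PiE_def Pi_def)
  have "coef (exp_lin c * exp_lin (\<lambda>v. - c v)) \<mu>
      = (\<Sum>\<alpha>\<in>PiE UNIV (\<lambda>v. {..\<mu> v}). \<Prod>v\<in>UNIV.
           (c v ^ \<alpha> v / fact (\<alpha> v)) * ((- c v) ^ (\<mu> v - \<alpha> v) / fact (\<mu> v - \<alpha> v)))"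
    by (simp only: times_series.rep_eq exp_lin_def coef_Series b prod.distrib)
  also have "\<dots> = (\<Prod>v\<in>UNIV. \<Sum>i\<le>\<mu> v. (c v ^ i / fact i) * ((- c v) ^ (\<mu> v - i) / fact (\<mu> v - i)))"
    by (rule prod_sum_PiE [symmetric]) auto
  also have "\<dots> = (\<Prod>v\<in>UNIV. if \<mu> v = 0 then 1 else 0)"
  proof (rule prod.cong[OF refl])
    fix v
    have "(\<Sum>i\<le>\<mu> v. (c v ^ i / fact i) * ((- c v) ^ (\<mu> v - i) / fact (\<mu> v - i)))
       = (\<Sum>i\<le>\<mu> v. real (\<mu> v choose i) * c v ^ i * (- c v) ^ (\<mu> v - i)) / fact (\<mu> v)"
      by (simp add: sum_divide_distrib binomial_fact field_simps)
    also have "\<dots> = (c v + - c v) ^ \<mu> v / fact (\<mu> v)"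
      by (simp only: binomial_ring)
    also have "\<dots> = (if \<mu> v = 0 then 1 else 0)" by simp
    finally show "(\<Sum>i\<le>\<mu> v. (c v ^ i / fact i) * ((- c v) ^ (\<mu> v - i) / fact (\<mu> v - i)))
       = (if \<mu> v = 0 then 1 else 0)" .
  qed
  also have "\<dots> = coef 1 \<mu>"
    by (auto simp: one_series.rep_eq fun_eq_iff)
  finally show "coef (exp_lin c * exp_lin (\<lambda>v. - c v)) \<mu> = coef 1 \<mu>" .
qed

section \<open>The two bases\<close>

datatype idx = K000 | K100 | K200 | K010 | K020 | K210
  | K001 | K101 | K201 | K011 | K021 | K211

lemma UNIV_idx: "UNIV = {K000, K100, K200, K010, K020, K210, K001, K101, K201, K011, K021, K211}"
  by (auto intro: idx.exhaust)

instance idx :: finite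
  by standard (simp add: UNIV_idx)

fun exps :: "idx \<Rightarrow> nat \<times> nat \<times> nat" where
  "exps K000 = (0,0,0)" | "exps K100 = (1,0,0)" | "exps K200 = (2,0,0)"
| "exps K010 = (0,1,0)" | "exps K020 = (0,2,0)" | "exps K210 = (2,1,0)"
| "exps K001 = (0,0,1)" | "exps K101 = (1,0,1)" | "exps K201 = (2,0,1)"
| "exps K011 = (0,1,1)" | "exps K021 = (0,2,1)" | "exps K211 = (2,1,1)"

fun size_idx :: "idx \<Rightarrow> nat" where
  "size_idx k = (case exps k of (a, b, c) \<Rightarrow> a + b + c)"

fun dual :: "idx \<Rightarrow> idx" where
  "dual K000 = K211" | "dual K100 = K021" | "dual K200 = K011"
| "dual K010 = K201" | "dual K020 = K101" | "dual K210 = K001"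
| "dual K001 = K210" | "dual K101 = K020" | "dual K201 = K010"
| "dual K011 = K200" | "dual K021 = K100" | "dual K211 = K000"

lemma dual_iff: "dual k = l \<longleftrightarrow> exps k + exps l \<in> {(2,1,1), (1,2,1)}"
  by (cases k; cases l) (simp_all add: plus_prod_def)

text \<open>\<open>Y k\<close> and \<open>Ys k\<close> stand for the variables \<open>y\<^sub>k\<close> and \<open>y\<^sup>*\<^sub>k\<close>.\<close>

datatype var = Y idx | Ys idx

instance var :: finite
proof
  have "(UNIV :: var set) = range Y \<union> range Ys"
  proof (intro equalityI subsetI)
    fix x :: var
    show "x \<in> range Y \<union> range Ys" by (cases x) auto
  qed simp
  then show "finite (UNIV :: var set)" by (metis finite_UnI finite_imageI finite)
qed

section \<open>The Semple bundle and its divisor classes\<close>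

text \<open>
  A point of \<open>S\<^sub>1\<close> is a pair of a point \<open>p\<close> and a line \<open>l\<close> with \<open>l \<cdot> p = 0\<close>, in homogeneous
  coordinates. A tangent vector of \<open>S\<^sub>1\<close> is a pair \<open>(v, e)\<close> with \<open>l \<cdot> v + e \<cdot> p = 0\<close>, where \<open>v\<close> matters
  modulo \<open>p\<close> and \<open>e\<close> modulo \<open>l\<close>. It lies in the focal plane if \<open>v\<close> is tangent to the line \<open>l\<close>, that is
  \<open>l \<cdot> v = 0\<close>, and it vanishes iff \<open>p \<times> v = 0\<close> and \<open>l \<times> e = 0\<close>. Its direction is a point of \<open>S\<^sub>2\<close>.
\<close>

type_synonym semple = "(complex^3) \<times> (complex^3) \<times> (complex^3) \<times> (complex^3)"

definition dotc :: "complex^3 \<Rightarrow> complex^3 \<Rightarrow> complex" where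
  "dotc a b = (\<Sum>i\<in>UNIV. a $ i * b $ i)"

definition crossc :: "complex^3 \<Rightarrow> complex^3 \<Rightarrow> complex^3" where
  "crossc a b = vector [a$2 * b$3 - a$3 * b$2, a$3 * b$1 - a$1 * b$3, a$1 * b$2 - a$2 * b$1]"

definition S2 :: "semple set" where
  "S2 = {(p, l, v, e). p \<noteq> 0 \<and> l \<noteq> 0 \<and> dotc l p = 0
      \<and> dotc l v + dotc e p = 0 \<and> dotc l v = 0
      \<and> \<not> (crossc p v = 0 \<and> crossc l e = 0)}"

definition div_I :: "semple set" where
  "div_I = {(p, l, v, e) \<in> S2. crossc p v = 0}"

definition div_Z :: "semple set" where
  "div_Z = {(p, l, v, e) \<in> S2. crossc l e = 0}"

text \<open>
  Classes are represented by Chern forms \<open>(\<i> / 2 \<pi>) \<partial>\<bar>\<partial> \<phi>\<close>, given by a local potential \<open>\<phi>\<close> which is the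
  logarithm of the squared norm of a holomorphic frame of the dual line bundle; another choice of
  homogeneous coordinates or frame changes \<open>\<phi>\<close> by a pluriharmonic function. The potential \<open>pot_taut\<close>
  belongs to the dual of the tautological subbundle of the focal bundle, where the focal plane is the
  orthogonal sum of the tangent line \<open>v\<close> of \<open>S\<^sub>1\<close> over the dual plane and the tangent line \<open>e\<close> of \<open>S\<^sub>1\<close> over
  the plane, each with its Fubini-Study norm. On the tautological subbundle \<open>I\<close> is the zero
  scheme of the projection to the first summand, and \<open>Z\<close> that of the projection to the second. The
  first summand has Chern class \<open>2 h - h\<^sup>\<or>\<close> and the second one \<open>2 h\<^sup>\<or> - h\<close>; this gives \<open>pot_i\<close> and \<open>pot_z\<close>.
\<close>

definition fubini :: "complex^3 \<Rightarrow> complex^3 \<Rightarrow> real" where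
  "fubini p v = norm (crossc p v) / (norm p)\<^sup>2"

fun pot_h :: "semple \<Rightarrow> real" where
  "pot_h (p, l, v, e) = ln ((norm p)\<^sup>2)"

fun pot_hd :: "semple \<Rightarrow> real" where
  "pot_hd (p, l, v, e) = ln ((norm l)\<^sup>2)"

fun pot_taut :: "semple \<Rightarrow> real" where
  "pot_taut (p, l, v, e) = ln ((fubini p v)\<^sup>2 + (fubini l e)\<^sup>2)"

definition pot_i :: "semple \<Rightarrow> real" where
  "pot_i x = pot_taut x + (2 * pot_h x - pot_hd x)"

definition pot_z :: "semple \<Rightarrow> real" where
  "pot_z x = pot_taut x + (2 * pot_hd x - pot_h x)"

text \<open>Products of divisor classes are lists of potentials.\<close>

definition Ybasis :: "idx \<Rightarrow> (semple \<Rightarrow> real) list" where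
  "Ybasis k = (case exps k of (a, b, c) \<Rightarrow> replicate a pot_h @ replicate b pot_hd @ replicate c pot_z)"

definition Ysbasis :: "idx \<Rightarrow> (semple \<Rightarrow> real) list" where
  "Ysbasis k = (case exps k of (a, b, c) \<Rightarrow> replicate a pot_h @ replicate b pot_hd @ replicate c pot_i)"

definition pull :: "('q \<Rightarrow> semple) \<Rightarrow> (semple \<Rightarrow> real) list \<Rightarrow> ('q \<Rightarrow> real) list" where
  "pull f \<phi>s = map (\<lambda>\<phi> q. \<phi> (f q)) \<phi>s"

section \<open>Integration of products of Chern forms\<close>

text \<open>Points of complex \<open>N\<close>-space are functions \<open>q\<close>, evaluated on indices below \<open>N\<close>.\<close>

definition wirtinger :: "nat \<Rightarrow> ((nat \<Rightarrow> complex) \<Rightarrow> complex) \<Rightarrow> (nat \<Rightarrow> complex) \<Rightarrow> complex" where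
  "wirtinger j F q =
     (vector_derivative (\<lambda>s::real. F (q(j := q j + of_real s))) (at 0)
      - \<i> * vector_derivative (\<lambda>s::real. F (q(j := q j + \<i> * of_real s))) (at 0)) / 2"

definition wirtinger_bar :: "nat \<Rightarrow> ((nat \<Rightarrow> complex) \<Rightarrow> complex) \<Rightarrow> (nat \<Rightarrow> complex) \<Rightarrow> complex" where
  "wirtinger_bar j F q =
     (vector_derivative (\<lambda>s::real. F (q(j := q j + of_real s))) (at 0)
      + \<i> * vector_derivative (\<lambda>s::real. F (q(j := q j + \<i> * of_real s))) (at 0)) / 2"

definition levi :: "((nat \<Rightarrow> complex) \<Rightarrow> real) \<Rightarrow> nat \<Rightarrow> nat \<Rightarrow> (nat \<Rightarrow> complex) \<Rightarrow> complex" where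
  "levi \<phi> j k q = wirtinger j (wirtinger_bar k (\<lambda>q. of_real (\<phi> q))) q"

text \<open>
  The integral over complex \<open>N\<close>-space of the wedge product of the forms \<open>(\<i> / 2 \<pi>) \<partial>\<bar>\<partial> \<phi>\<close> for \<open>\<phi>\<close> in the
  list, which is zero unless there are exactly \<open>N\<close> of them. Expanding the wedge product gives the
  double sum below times the product of the \<open>(\<i> / 2 \<pi>) dq\<^sub>j \<and> d\<bar>q\<^sub>j\<close>, each of which is Lebesgue measure
  divided by \<open>\<pi>\<close>. The forms are smooth off a null set only, hence the completion of the measure.
\<close>

definition chern_integral :: "nat \<Rightarrow> ((nat \<Rightarrow> complex) \<Rightarrow> real) list \<Rightarrow> real" where
  "chern_integral N \<phi>s =
    (if length \<phi>s = N then
       Re (LINT q | completion (\<Pi>\<^sub>M j\<in>{..<N}. lborel).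
         (\<Sum>\<sigma> | \<sigma> permutes {..<N}. \<Sum>\<tau> | \<tau> permutes {..<N}.
            of_int (sign \<sigma> * sign \<tau>) * (\<Prod>r<N. levi (\<phi>s ! r) (\<sigma> r) (\<tau> r) q))) / pi ^ N
     else 0)"

section \<open>The potential of the double and triple covers\<close>

text \<open>
  A general member of the moduli space of three-twig maps without free markings is determined, up to
  isomorphism, by \<open>q = (x, y, m\<^sub>1, m\<^sub>2, w\<^sub>1, w\<^sub>2)\<close>: the point \<open>(x, y)\<close> over which the fiber of \<open>S\<^sub>1\<close> lies, the
  slopes \<open>m\<^sub>1\<close>, \<open>m\<^sub>2\<close> of the two branch points of the double cover, and the positions \<open>w\<^sub>1\<close>, \<open>w\<^sub>2\<close> of the
  markings \<open>n + 1\<close>, \<open>n + 2\<close> in the fibers of \<open>S\<^sub>2\<close> over these two points of \<open>S\<^sub>1\<close>. The chart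
  \<open>chart x y m w\<close> of \<open>S\<^sub>2\<close> is the direction \<open>dx = w dm\<close>, \<open>dy = m dx\<close> at the point \<open>(x, y)\<close> with slope \<open>m\<close>;
  here \<open>I\<close> is \<open>w = 0\<close>, and it contains the lift of the fiber of \<open>S\<^sub>1\<close>.
\<close>

definition chart :: "complex \<Rightarrow> complex \<Rightarrow> complex \<Rightarrow> complex \<Rightarrow> semple" where
  "chart x y m w = (vector [1, x, y], vector [y - m * x, m, -1], vector [0, w, m * w], vector [- x, 1, 0])"

lemma chart_in_S2: "chart x y m w \<in> S2"
  by (auto simp: chart_def S2_def dotc_def crossc_def sum_3 vec_eq_iff forall_3 vector_3)

lemma chart_in_div_I: "chart x y m w \<in> div_I \<longleftrightarrow> w = 0"
  using chart_in_S2[of x y m w]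
  by (auto simp: chart_def div_I_def crossc_def vec_eq_iff forall_3 vector_3)

text \<open>
  On the central twig the double cover ramified over \<open>m\<^sub>1\<close>, \<open>m\<^sub>2\<close> is written with its ramification points
  at \<open>0\<close>, \<open>\<infinity>\<close>; on a peripheral twig the triple cover totally ramified over \<open>0\<close> (the attachment point) and
  over \<open>w\<^sub>j\<close> is written in the same way.
\<close>

datatype twig = Central | Periph1 | Periph2

fun twig_point :: "twig \<Rightarrow> complex \<Rightarrow> (nat \<Rightarrow> complex) \<Rightarrow> semple" where
  "twig_point Central t q = chart (q 0) (q 1) ((q 2 + q 3 * t^2) / (1 + t^2)) 0"
| "twig_point Periph1 t q = chart (q 0) (q 1) (q 2) (q 4 * t^3 / (1 + t^3))"
| "twig_point Periph2 t q = chart (q 0) (q 1) (q 3) (q 5 * t^3 / (1 + t^3))"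

lemma twig_point_attach:
  "twig_point Central 0 q = twig_point Periph1 0 q"
  "((\<lambda>t. (q 2 + q 3 * t^2) / (1 + t^2)) \<longlongrightarrow> q 3) at_infinity"
proof -
  show "twig_point Central 0 q = twig_point Periph1 0 q" by simp
  have i: "((\<lambda>t::complex. inverse t) \<longlongrightarrow> 0) at_infinity"
    by (rule tendsto_inverse_0)
  have "((\<lambda>t. (q 2 * inverse t ^ 2 + q 3) / (inverse t ^ 2 + 1)) \<longlongrightarrow> (q 2 * 0 ^ 2 + q 3) / (0 ^ 2 + 1)) at_infinity"
    by (intro tendsto_intros i) simp
  moreover have "\<forall>\<^sub>F t in at_infinity. (q 2 * inverse t ^ 2 + q 3) / (inverse t ^ 2 + 1) = (q 2 + q 3 * t^2) / (1 + t^2)"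
    using eventually_not_equal_at_infinity[of 0]
  proof eventually_elim
    case (elim t)
    have "(q 2 + q 3 * t^2) / (1 + t^2) = (inverse t ^ 2 * (q 2 + q 3 * t^2)) / (inverse t ^ 2 * (1 + t^2))"
      using elim by simp
    also have "\<dots> = (q 2 * inverse t ^ 2 + q 3) / (inverse t ^ 2 + 1)"
      using elim by (simp add: distrib_left field_simps)
    finally show ?case ..
  qed
  ultimately show "((\<lambda>t. (q 2 + q 3 * t^2) / (1 + t^2)) \<longlongrightarrow> q 3) at_infinity"
    by (simp add: filterlim_cong)
qed

text \<open>
  The integral over the moduli stack of the pullbacks of the classes \<open>Y\<^sub>k\<close> for \<open>k\<close> in \<open>ks\<close> at the free
  markings and of \<open>Y\<^sup>*\<^sub>l\<close>, \<open>Y\<^sup>*\<^sub>l\<^sub>'\<close> at the last two. It has one component for each distribution \<open>tw\<close> of the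
  free markings on the twigs; on a dense open subset, the coordinate of the \<open>j\<close>-th free marking on its
  twig is \<open>q (6 + j)\<close>. The group of order \<open>2 \<cdot> 3 \<cdot> 3 = 18\<close> of deck transformations of the three covers acts
  on these coordinates, and the stack is the quotient.
\<close>

definition T_integral :: "idx list \<Rightarrow> idx \<Rightarrow> idx \<Rightarrow> real" where
  "T_integral ks l l' =
    (\<Sum>tw | length tw = length ks \<and> set tw \<subseteq> {Central, Periph1, Periph2}.
       chern_integral (6 + length ks)
         (concat (map (\<lambda>j. pull (\<lambda>q. twig_point (tw ! j) (q (6 + j)) q) (Ybasis (ks ! j))) [0..<length ks])
          @ pull (\<lambda>q. chart (q 0) (q 1) (q 2) (q 4)) (Ysbasis l)
          @ pull (\<lambda>q. chart (q 0) (q 1) (q 3) (q 5)) (Ysbasis l'))) / 18"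

text \<open>
  The potential, with \<open>\<gamma>\<close> and \<open>\<delta>\<close> expanded by multilinearity. The summand for \<open>n\<close> has degree \<open>n + 2\<close>,
  so that only finitely many \<open>n\<close> contribute to a coefficient.
\<close>

definition TT :: "var series" where
  "TT = Series (\<lambda>\<mu>.
     \<Sum>n\<le>(\<Sum>v\<in>UNIV. \<mu> v). \<Sum>ks | length ks = n. \<Sum>l\<in>UNIV. \<Sum>l'\<in>UNIV.
       if count_list (map Y ks @ [Ys l, Ys l']) = \<mu> then T_integral ks l l' / (2 * fact n) else 0)"

section \<open>The quantum potential\<close>

definition big :: "idx list" where
  "big = [K200, K020, K210, K101, K201, K011, K021, K211]"

definition weight :: "(idx \<Rightarrow> nat) \<Rightarrow> nat" where
  "weight a = (\<Sum>k\<in>set big. (size_idx k - 1) * a k)"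

text \<open>
  \<open>potential c d\<close> is the polynomial of the shape of the quantum potential in degree \<open>d\<close>, with arbitrary
  numbers \<open>c d a\<close> in place of the characteristic numbers.
\<close>

definition potential :: "(nat \<Rightarrow> (idx \<Rightarrow> nat) \<Rightarrow> real) \<Rightarrow> nat \<Rightarrow> var series" where
  "potential c d = Series (\<lambda>\<mu>.
     if (\<forall>v. v \<notin> Y ` set big \<longrightarrow> \<mu> v = 0) \<and> weight (\<mu> \<circ> Y) = 3 * d - 1
     then c d (\<mu> \<circ> Y) / (\<Prod>k\<in>set big. fact (\<mu> (Y k)))
     else 0)"

fun E_exponent :: "nat \<Rightarrow> var \<Rightarrow> real" where
  "E_exponent d (Y K100) = d"
| "E_exponent d (Y K010) = 2 * real d - 2"
| "E_exponent d (Y K001) = 3 * real d - 6"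
| "E_exponent d _ = 0"

definition E :: "nat \<Rightarrow> var series" where
  "E d = exp_lin (E_exponent d)"

definition E_inv :: "nat \<Rightarrow> var series" where
  "E_inv d = exp_lin (\<lambda>v. - E_exponent d v)"

lemma E_mult_E_inv: "E d * E_inv d = 1"
  unfolding E_def E_inv_def by (rule exp_lin_mult_minus)

definition satisfies_equation :: "(nat \<Rightarrow> var series) \<Rightarrow> nat \<Rightarrow> bool" where
  "satisfies_equation N d \<longleftrightarrow>
     (pd (Y K200) ^^ 3) (N d) =
       18 * E_inv d *
       (\<Sum>(d1, d2) \<in> {(d1, d2). d1 + d2 = d \<and> d1 > 0 \<and> d2 > 0}. \<Sum>s\<in>UNIV. \<Sum>t\<in>UNIV.
          of_nat (d1 * d2)
            * pd (Y s) (pd (Y K200) (N d1) * E d1)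
            * pd (Ys (dual s)) (pd (Ys (dual t)) TT)
            * pd (Y t) (pd (Y K200) (N d2) * E d2)
          - of_nat (d1\<^sup>2)
            * pd (Y s) (N d1 * E d1)
            * pd (Ys (dual s)) (pd (Ys (dual t)) TT)
            * pd (Y t) (pd (Y K200) (pd (Y K200) (N d2)) * E d2))"

section \<open>The characteristic numbers\<close>

text \<open>
  The general degree \<open>d\<close> map from the projective line is isomorphic to exactly \<open>d\<^sup>3\<close> maps in the family
  \<open>curve d q\<close>, where \<open>q\<close> has \<open>3 d - 1\<close> coordinates: reparametrize so that \<open>0\<close>, \<open>\<infinity>\<close> and \<open>1\<close> are
  mapped to the first, second and third coordinate line respectively, and scale so that the third
  component starts with \<open>-1\<close>.
\<close>

definition curve :: "nat \<Rightarrow> (nat \<Rightarrow> complex) \<Rightarrow> complex poly \<times> complex poly \<times> complex poly" where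
  "curve d q =
     (\<Sum>j<d. monom (q j) (j + 1),
      \<Sum>j<d. monom (q (d + j)) j,
      [:-1, 1:] * (1 + (\<Sum>j<d - 1. monom (q (2 * d + j)) (j + 1))))"

text \<open>
  The second-order lift at the parameter \<open>t\<close> of a map \<open>f\<close>: the point \<open>f\<close>, the tangent line \<open>f \<times> f'\<close>,
  and the derivatives \<open>f'\<close> and \<open>(f \<times> f')' = f \<times> f''\<close> of these two.
\<close>

fun lift2 :: "complex poly \<times> complex poly \<times> complex poly \<Rightarrow> complex \<Rightarrow> semple" where
  "lift2 (f, g, h) t =
     (let F = vector [poly f t, poly g t, poly h t];
          F1 = vector [poly (pderiv f) t, poly (pderiv g) t, poly (pderiv h) t];
          F2 = vector [poly (pderiv (pderiv f)) t, poly (pderiv (pderiv g)) t, poly (pderiv (pderiv h)) t]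
      in (F, crossc F F1, F1, crossc F F2))"

lemma dotc_crossc: "dotc (crossc a b) a = 0" "dotc (crossc a b) b = 0"
  by (simp_all add: dotc_def crossc_def sum_3 vector_3 algebra_simps)

lemma lift2_focal:
  assumes "lift2 c t = (p, l, v, e)"
  shows "dotc l p = 0" "dotc l v = 0" "dotc e p = 0"
  using assms by (cases c; clarsimp simp: Let_def dotc_crossc)+

definition N_number :: "nat \<Rightarrow> (idx \<Rightarrow> nat) \<Rightarrow> real" where
  "N_number d a =
    (let ks = concat (map (\<lambda>k. replicate (a k) k) big) in
     chern_integral (3 * d - 1 + length ks)
       (concat (map (\<lambda>j. pull (\<lambda>q. lift2 (curve d q) (q (3 * d - 1 + j))) (Ybasis (ks ! j))) [0..<length ks]))
     / real d ^ 3)"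

end

theory Submission
  imports Defs
begin

text \<open>
  Filter series by their degree in \<open>y\<^sub>2\<^sub>0\<^sub>0\<close>. Since \<open>y\<^sub>2\<^sub>0\<^sub>0\<close> has weight 1, \<open>N\<^sup>(\<^sup>d\<^sup>)\<close> has degree at most
  \<open>3 d - 1\<close>, and the derivative of order \<open>3 d - 3\<close> knows \<open>N\<^sup>(\<^sup>d\<^sup>)\<close> up to terms of degree at most
  \<open>3 d - 4\<close>. Two insertions of \<open>h\<^sup>2\<close>, one of \<open>h\<^sup>2\<close> with another \<open>h\<close>, or one of \<open>h\<^sup>2\<close> with \<open>h\<^sup>\<or>\<^sup>2\<close> at one of the last two
  markings vanish on the three-twig space, because the forms involve too few coordinates. Hence
  \<open>\<T>\<^bsub>s*t*\<^esub>\<close> is free of \<open>y\<^sub>2\<^sub>0\<^sub>0\<close> unless \<open>s\<close> and \<open>t\<close> are in \<open>{200, 210, 201, 211}\<close>, where it has degree at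
  most 1; but the derivatives by \<open>y\<^sub>s\<close> and \<open>y\<^sub>t\<close> then lower the degree of the known factor by 1. So
  an error of degree 3 below the maximum in one factor gives an error of degree at most \<open>3 d - 7\<close> on
  the right-hand side, and three integrations complete the induction.
\<close>

section \<open>Degree bounds for series\<close>

text \<open>The bound is an integer so that differentiation may push it below 0, where it forces the
  series to vanish. Variables outside \<open>S\<close> are unrestricted, so exponentials in those
  have degree 0.\<close>

definition deg_le :: "'v set \<Rightarrow> int \<Rightarrow> 'v series \<Rightarrow> bool" where
  "deg_le S k f \<longleftrightarrow> (\<forall>\<mu>. coef f \<mu> \<noteq> 0 \<longrightarrow> int (\<Sum>v\<in>S. \<mu> v) \<le> k)"

lemma deg_leD: "deg_le S k f \<Longrightarrow> coef f \<mu> \<noteq> 0 \<Longrightarrow> int (\<Sum>v\<in>S. \<mu> v) \<le> k"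
  by (simp add: deg_le_def)

lemma deg_le_mono: "deg_le S k f \<Longrightarrow> k \<le> l \<Longrightarrow> deg_le S l f"
  by (force simp: deg_le_def)

lemma deg_le_subset:
  fixes S :: "'v::finite set"
  assumes "deg_le S k f" "R \<subseteq> S"
  shows "deg_le R k f"
  unfolding deg_le_def
proof (intro allI impI)
  fix \<mu> assume "coef f \<mu> \<noteq> 0"
  with assms(1) have "int (\<Sum>v\<in>S. \<mu> v) \<le> k" by (rule deg_leD)
  moreover have "(\<Sum>v\<in>R. \<mu> v) \<le> (\<Sum>v\<in>S. \<mu> v)"
    using assms(2) by (intro sum_mono2) auto
  ultimately show "int (\<Sum>v\<in>R. \<mu> v) \<le> k" by linarith
qed

lemma deg_le_zero [simp]: "deg_le S k (0 :: 'v::finite series)"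
  by (simp add: deg_le_def zero_series.rep_eq)

lemma deg_le_add: "deg_le S k f \<Longrightarrow> deg_le S k g \<Longrightarrow> deg_le S k (f + g :: 'v::finite series)"
  unfolding deg_le_def plus_series.rep_eq by (metis add_0)

lemma deg_le_diff: "deg_le S k f \<Longrightarrow> deg_le S k g \<Longrightarrow> deg_le S k (f - g :: 'v::finite series)"
  unfolding deg_le_def minus_series.rep_eq by (metis diff_0_right)

lemma deg_le_sum:
  "(\<And>i. i \<in> A \<Longrightarrow> deg_le S k (f i)) \<Longrightarrow> deg_le S k (sum f A :: 'v::finite series)"
  by (induction A rule: infinite_finite_induct) (auto intro: deg_le_add)

lemma deg_le_mult:
  fixes f g :: "'v::finite series"
  assumes "deg_le S k f" "deg_le S l g"
  shows "deg_le S (k + l) (f * g)"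
  unfolding deg_le_def
proof (intro allI impI)
  fix \<mu> assume "coef (f * g) \<mu> \<noteq> 0"
  then obtain \<alpha> where \<alpha>: "\<alpha> \<in> below \<mu>" "coef f \<alpha> * coef g (\<lambda>v. \<mu> v - \<alpha> v) \<noteq> 0"
    unfolding times_series.rep_eq by (meson sum.not_neutral_contains_not_neutral)
  have "(\<Sum>v\<in>S. \<mu> v) = (\<Sum>v\<in>S. \<alpha> v) + (\<Sum>v\<in>S. \<mu> v - \<alpha> v)"
    unfolding sum.distrib [symmetric] using \<alpha>(1) by (intro sum.cong) (auto simp: below_def)
  moreover have "int (\<Sum>v\<in>S. \<alpha> v) \<le> k" "int (\<Sum>v\<in>S. \<mu> v - \<alpha> v) \<le> l"
    using deg_leD [OF assms(1), of \<alpha>] deg_leD [OF assms(2), of "\<lambda>v. \<mu> v - \<alpha> v"] \<alpha>(2) by auto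
  ultimately show "int (\<Sum>v\<in>S. \<mu> v) \<le> k + l" by linarith
qed

lemma deg_le_of_nat: "deg_le S 0 (of_nat n :: 'v::finite series)"
proof (induction n)
  case (Suc n)
  have "deg_le S 0 (1 :: 'v series)"
    by (simp add: deg_le_def one_series.rep_eq)
  with Suc show ?case by (simp add: deg_le_add)
qed simp

lemma deg_le_of_nat_mult:
  "deg_le S k f \<Longrightarrow> deg_le S k (of_nat n * f :: 'v::finite series)"
  using deg_le_mult [OF deg_le_of_nat] by fastforce

lemma deg_le_exp_lin:
  assumes "\<And>v. v \<in> S \<Longrightarrow> c v = 0"
  shows "deg_le S 0 (exp_lin c)"
  unfolding deg_le_def
proof (intro allI impI)
  fix \<mu> assume "coef (exp_lin c) \<mu> \<noteq> 0"
  then have "c v ^ \<mu> v \<noteq> 0" for v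
    by (auto simp: exp_lin_def)
  then have "\<mu> v = 0" if "v \<in> S" for v
    using assms [OF that] by (metis power_0_left)
  then show "int (\<Sum>v\<in>S. \<mu> v) \<le> 0" by simp
qed

section \<open>Differentiation and degree\<close>

lemma sum_fun_upd_Suc:
  fixes \<mu> :: "'v::finite \<Rightarrow> nat"
  shows "(\<Sum>u\<in>S. (\<mu>(v := Suc (\<mu> v))) u) = (\<Sum>u\<in>S. \<mu> u) + (if v \<in> S then 1 else 0)"
proof -
  have "(\<Sum>u\<in>S. (\<mu>(v := Suc (\<mu> v))) u) = (\<Sum>u\<in>S. \<mu> u + (if u = v then 1 else 0))"
    by (intro sum.cong) auto
  then show ?thesis by (simp add: sum.distrib)
qed

lemma deg_le_pd:
  fixes f :: "'v::finite series"
  assumes "deg_le S k f"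
  shows "deg_le S (k - (if v \<in> S then 1 else 0)) (pd v f)"
  unfolding deg_le_def
proof (intro allI impI)
  fix \<mu> assume "coef (pd v f) \<mu> \<noteq> 0"
  then have "coef f (\<mu>(v := Suc (\<mu> v))) \<noteq> 0" by (auto simp: pd_def)
  from deg_leD [OF assms this] show "int (\<Sum>u\<in>S. \<mu> u) \<le> k - (if v \<in> S then 1 else 0)"
    unfolding sum_fun_upd_Suc by (auto split: if_splits)
qed

lemma deg_le_pd_weak:
  "deg_le S k f \<Longrightarrow> deg_le S k (pd v f :: 'v::finite series)"
  by (rule deg_le_mono [OF deg_le_pd]) auto

lemma deg_le_pd_in:
  "deg_le S k f \<Longrightarrow> v \<in> S \<Longrightarrow> deg_le S (k - 1) (pd v f :: 'v::finite series)"
  using deg_le_pd [of S k f v] by simp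

text \<open>Differentiation by \<open>v\<close> kills only the monomials free of \<open>v\<close>,
  which have degree 0; hence the condition \<open>0 \<le> k\<close>. All other coefficients survive
  up to a nonzero factor.\<close>

lemma deg_le_pd_cancel:
  fixes f :: "'v::finite series"
  assumes "deg_le {v} (k - 1) (pd v f)" "0 \<le> k"
  shows "deg_le {v} k f"
  unfolding deg_le_def
proof (intro allI impI)
  fix \<mu> assume \<mu>: "coef f \<mu> \<noteq> 0"
  show "int (\<Sum>u\<in>{v}. \<mu> u) \<le> k"
  proof (cases "\<mu> v")
    case 0
    then show ?thesis using assms(2) by simp
  next
    case (Suc m)
    then have "\<mu>(v := Suc m) = \<mu>" by auto
    with \<mu> have "coef (pd v f) (\<mu>(v := m)) \<noteq> 0" by (simp add: pd_def)
    from deg_leD [OF assms(1) this] show ?thesis using Suc by simp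
  qed
qed

lemma deg_le_pd_pow:
  fixes f :: "'v::finite series"
  assumes "deg_le S k f" "v \<in> S"
  shows "deg_le S (k - int n) ((pd v ^^ n) f)"
proof (induction n)
  case (Suc n)
  from deg_le_pd_in [OF Suc assms(2)] show ?case by (simp add: algebra_simps)
qed (simp add: assms)

lemma deg_le_neg_imp_zero: "deg_le S k f \<Longrightarrow> k < 0 \<Longrightarrow> f = (0 :: 'v::finite series)"
  by (rule series_eqI, rule ccontr) (force simp: zero_series.rep_eq simp del: of_nat_sum dest: deg_leD)

lemma pd_diff: "pd v (f - g) = pd v f - pd v (g :: 'v::finite series)"
  by (rule series_eqI) (simp add: pd_def minus_series.rep_eq algebra_simps)

lemma pd_pow_diff: "(pd v ^^ n) (f - g) = (pd v ^^ n) f - (pd v ^^ n) (g :: 'v::finite series)"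
  by (induction n) (simp_all add: pd_diff)

section \<open>Vanishing of integrals\<close>

text \<open>Coordinates are varied one at a time, as in the Wirtinger derivatives.\<close>

definition indep_off :: "nat set \<Rightarrow> ((nat \<Rightarrow> complex) \<Rightarrow> 'b) \<Rightarrow> bool" where
  "indep_off J F \<longleftrightarrow> (\<forall>q j x. j \<notin> J \<longrightarrow> F (q(j := x)) = F q)"

lemma indep_offD: "indep_off J F \<Longrightarrow> j \<notin> J \<Longrightarrow> F (q(j := x)) = F q"
  by (simp add: indep_off_def)

lemma wirtinger_eq_0: "indep_off J F \<Longrightarrow> j \<notin> J \<Longrightarrow> wirtinger j F q = 0"
  by (simp add: wirtinger_def indep_offD)

lemma wirtinger_bar_eq_0: "indep_off J F \<Longrightarrow> j \<notin> J \<Longrightarrow> wirtinger_bar j F q = 0"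
  by (simp add: wirtinger_bar_def indep_offD)

text \<open>Updates at distinct coordinates commute; for \<open>k\<close> outside \<open>J\<close>
  the derivative is identically 0.\<close>

lemma indep_off_wirtinger_bar:
  assumes "indep_off J F"
  shows "indep_off J (wirtinger_bar k F)"
proof (cases "k \<in> J")
  case True
  show ?thesis
    unfolding indep_off_def
  proof (intro allI impI)
    fix q :: "nat \<Rightarrow> complex" and j x
    assume j: "j \<notin> J"
    with True have "q(j := x, k := y) = q(k := y, j := x)" "(q(j := x)) k = q k" for y
      by (auto intro: fun_upd_twist)
    then show "wirtinger_bar k F (q(j := x)) = wirtinger_bar k F q"
      using indep_offD [OF assms j] by (simp add: wirtinger_bar_def)
  qed
next
  case False
  then show ?thesis by (simp add: indep_off_def wirtinger_bar_eq_0 [OF assms])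
qed

lemma levi_eq_0:
  assumes "indep_off J \<phi>" "j \<notin> J"
  shows "levi \<phi> j k q = 0"
proof -
  have "indep_off J (\<lambda>q. complex_of_real (\<phi> q))"
    using assms(1) by (simp add: indep_off_def)
  then show ?thesis
    unfolding levi_def using assms(2) by (blast intro: wirtinger_eq_0 indep_off_wirtinger_bar)
qed

text \<open>Pigeonhole: the injective \<open>\<sigma>\<close> must send the position of one of the
  potentials seeing only \<open>J\<close> outside \<open>J\<close>. Its Levi coefficient there is 0,
  so every term of the expanded wedge product vanishes pointwise.\<close>

lemma chern_integral_eq_0:
  assumes "finite J" "card J < length (filter (indep_off J) \<phi>s)"
  shows "chern_integral N \<phi>s = 0"
proof (cases "length \<phi>s = N")
  case True
  let ?R = "{r. r < N \<and> indep_off J (\<phi>s ! r)}"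
  have R: "card J < card ?R"
    using assms(2) True by (simp add: length_filter_conv_card)
  have "(\<Prod>r<N. levi (\<phi>s ! r) (\<sigma> r) (\<tau> r) q) = 0" if "\<sigma> permutes {..<N}" for \<sigma> \<tau> q
  proof -
    have "\<not> \<sigma> ` ?R \<subseteq> J"
    proof
      assume "\<sigma> ` ?R \<subseteq> J"
      then have "card (\<sigma> ` ?R) \<le> card J" by (rule card_mono [OF assms(1)])
      moreover have "inj_on \<sigma> ?R"
        using permutes_inj [OF that] by (rule inj_on_subset) simp
      ultimately show False using R by (simp add: card_image)
    qed
    then obtain r where "r < N" "indep_off J (\<phi>s ! r)" "\<sigma> r \<notin> J" by blast
    then show ?thesis by (auto intro!: prod_zero levi_eq_0)
  qed
  then have "(\<Sum>\<sigma> | \<sigma> permutes {..<N}. \<Sum>\<tau> | \<tau> permutes {..<N}.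
      of_int (sign \<sigma> * sign \<tau>) * (\<Prod>r<N. levi (\<phi>s ! r) (\<sigma> r) (\<tau> r) q)) = 0" for q
    by (intro sum.neutral ballI) simp
  then show ?thesis by (simp add: chern_integral_def del: of_int_mult)
qed (simp add: chern_integral_def)

section \<open>Which coordinates the classes depend on\<close>

lemma indep_off_h:
  "indep_off {0, 1} (\<lambda>q. pot_h (chart (q 0) (q 1) (m q) (w q)))"
  by (simp add: indep_off_def chart_def)

lemma indep_off_hd:
  "indep_off {0, 1, i} (\<lambda>q. pot_hd (chart (q 0) (q 1) (q i) (w q)))"
  by (simp add: indep_off_def chart_def)

lemma indep_off_subset: "indep_off J F \<Longrightarrow> J \<subseteq> K \<Longrightarrow> indep_off K F"
  by (auto simp: indep_off_def)

text \<open>All three twigs lie over the same base point \<open>(q 0, q 1)\<close>.\<close>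

lemma indep_off_twig_h:
  "indep_off {0, 1} (\<lambda>q. pot_h (twig_point tw (q j) q))"
  by (cases tw) (simp_all add: indep_off_def chart_def)

text \<open>
  \<open>{0, 1}\<close> are the coordinates of the base point, and coordinate 2 or 3 adds the slope at
  one of the last two markings.
\<close>

lemma T_integral_nonzero:
  assumes "T_integral ks l l' \<noteq> 0"
  shows "count_list ks K200 \<le> 1"
    and "K200 \<in> set ks \<Longrightarrow> l \<in> {K000, K010, K001, K011} \<and> l' \<in> {K000, K010, K001, K011}"
proof -
  define n where "n = length ks"
  define free where "free tw = concat (map (\<lambda>j. pull (\<lambda>q. twig_point (tw ! j) (q (6 + j)) q)
      (Ybasis (ks ! j))) [0..<n])" for tw
  define m1 where "m1 = pull (\<lambda>q :: nat \<Rightarrow> complex. chart (q 0) (q 1) (q 2) (q 4)) (Ysbasis l)"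
  define m2 where "m2 = pull (\<lambda>q :: nat \<Rightarrow> complex. chart (q 0) (q 1) (q 3) (q 5)) (Ysbasis l')"
  define cnt where "cnt J L = length (filter (indep_off J) L)"
    for J and L :: "((nat \<Rightarrow> complex) \<Rightarrow> real) list"
  from assms have "(\<Sum>tw | length tw = length ks \<and> set tw \<subseteq> {Central, Periph1, Periph2}.
      chern_integral (6 + n) (free tw @ m1 @ m2)) \<noteq> 0"
    unfolding T_integral_def free_def m1_def m2_def n_def by (metis div_0)
  then obtain tw where tw: "chern_integral (6 + n) (free tw @ m1 @ m2) \<noteq> 0"
    by (meson sum.not_neutral_contains_not_neutral)
  have bound: "cnt J (free tw) + cnt J m1 + cnt J m2 \<le> card J" if "finite J" for J
  proof (rule ccontr)
    assume "\<not> ?thesis"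
    then have "card J < length (filter (indep_off J) (free tw @ m1 @ m2))" by (simp add: cnt_def)
    with tw chern_integral_eq_0 [OF that] show False by blast
  qed
  \<comment> \<open>Each insertion of h^2 contributes two forms pulled back from the base; other
    insertions may add more, hence an inequality.\<close>
  have cnt_free: "2 * count_list ks K200 \<le> cnt J (free tw)" if "{0, 1} \<subseteq> J" for J
  proof -
    have h: "indep_off J (\<lambda>q. pot_h (twig_point tw (q j) q))" for tw j
      using indep_off_twig_h that by (rule indep_off_subset)
    have "2 * count_list ks K200 = sum_list (map (\<lambda>k. if k = K200 then 2 else 0) ks)"
      by (induction ks) auto
    also have "\<dots> = sum_list (map (\<lambda>k. if k = K200 then 2 else 0) (map ((!) ks) [0..<n]))"
      by (simp add: n_def map_nth)
    also have "\<dots> = sum_list (map (\<lambda>j. if ks ! j = K200 then 2 else 0) [0..<n])"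
      by (simp add: o_def)
    also have "\<dots> \<le> sum_list (map (\<lambda>j. cnt J
          (pull (\<lambda>q. twig_point (tw ! j) (q (6 + j)) q) (Ybasis (ks ! j)))) [0..<n])"
      by (rule sum_list_mono) (simp add: cnt_def Ybasis_def pull_def numeral_2_eq_2 h)
    also have "\<dots> = cnt J (free tw)"
      by (simp add: cnt_def free_def filter_concat length_concat o_def)
    finally show ?thesis .
  qed
  from cnt_free [of "{0, 1}"] bound [of "{0, 1}"] show "count_list ks K200 \<le> 1" by simp
  assume "K200 \<in> set ks"
  then have "1 \<le> count_list ks K200"
    using count_list_0_iff [of ks K200] by linarith
  \<comment> \<open>The insertion of h^2 uses up two coordinates of \<open>J\<close>; only the
    others are left for the last two markings.\<close>
  then have markings: "cnt J m1 + cnt J m2 \<le> card J - 2"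
    if "finite J" "{0, 1} \<subseteq> J" for J
    using bound [OF that(1)] cnt_free [OF that(2)] by linarith
  have h: "indep_off J (\<lambda>q. pot_h (chart (q 0) (q 1) (m q) (w q)))" if "{0, 1} \<subseteq> J" for J m w
    using indep_off_h that by (rule indep_off_subset)
  have hd: "indep_off {0, 1, 2} (\<lambda>q. pot_hd (chart (q 0) (q 1) (q 2) (w q)))"
      "indep_off {0, 1, 3} (\<lambda>q. pot_hd (chart (q 0) (q 1) (q 3) (w q)))" for w
    by (rule indep_off_hd)+
  have rep: "replicate 1 x = [x]" "replicate 2 x = [x, x]" for x :: 'x
    by (simp_all add: numeral_2_eq_2)
  \<comment> \<open>The first count rules out h at marking n + 1; the second allows the dual class
    at most once, since only the slope coordinate 2 is left.\<close>
  have "cnt {0, 1} m1 = 0" "cnt {0, 1, 2} m1 \<le> 1"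
    using markings [of "{0, 1}"] markings [of "{0, 1, 2}"] by simp_all
  then have "l \<in> {K000, K010, K001, K011}"
    unfolding cnt_def m1_def Ysbasis_def pull_def
    by (cases l) (simp_all add: rep h hd del: One_nat_def)
  moreover have "cnt {0, 1} m2 = 0" "cnt {0, 1, 3} m2 \<le> 1"
    using markings [of "{0, 1}"] markings [of "{0, 1, 3}"] by simp_all
  then have "l' \<in> {K000, K010, K001, K011}"
    unfolding cnt_def m2_def Ysbasis_def pull_def
    by (cases l') (simp_all add: rep h hd del: One_nat_def)
  ultimately show "l \<in> {K000, K010, K001, K011} \<and> l' \<in> {K000, K010, K001, K011}" ..
qed

section \<open>Degree bounds for the recursion\<close>

definition V200 :: "var set" where "V200 = {Y K200}"

text \<open>The classes divisible by h^2. Under \<open>dual\<close> they correspond to those that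
  may stand at the last two markings next to an insertion of h^2.\<close>

definition Vfib :: "var set" where "Vfib = Y ` {K200, K210, K201, K211}"

lemma V200_subset: "V200 \<subseteq> Vfib"
  by (auto simp: V200_def Vfib_def)

lemma coef_TT_nonzero:
  assumes "coef TT \<mu> \<noteq> 0"
  obtains ks l l' where "count_list (map Y ks @ [Ys l, Ys l']) = \<mu>" "T_integral ks l l' \<noteq> 0"
proof -
  from assms obtain n where "(\<Sum>ks | length ks = n. \<Sum>l\<in>UNIV. \<Sum>l'\<in>UNIV.
       if count_list (map Y ks @ [Ys l, Ys l']) = \<mu> then T_integral ks l l' / (2 * fact n) else 0) \<noteq> 0"
    unfolding TT_def coef_Series by (meson sum.not_neutral_contains_not_neutral)
  then obtain ks l l' where
    "(if count_list (map Y ks @ [Ys l, Ys l']) = \<mu> then T_integral ks l l' / (2 * fact n) else 0) \<noteq> 0"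
    by (elim sum.not_neutral_contains_not_neutral) blast
  then show thesis by (intro that [of ks l l']) (auto split: if_splits)
qed

lemma count_list_map_Y: "count_list (map Y ks @ [Ys l, Ys l']) (Y k) = count_list ks k"
  by (induction ks) auto

lemma count_list_map_Ys:
  "count_list (map Y ks @ [Ys l, Ys l']) (Ys k) = (if l = k then 1 else 0) + (if l' = k then 1 else 0)"
  by (induction ks) auto

text \<open>The derivatives select terms with \<open>dual s\<close> and \<open>dual t\<close> at the
  last two markings. A factor \<open>Y K200\<close> in such a term occurs only once and puts both
  \<open>Y s\<close> and \<open>Y t\<close> into \<open>Vfib\<close>.\<close>

lemma deg_le_pd_TT:
  "deg_le V200 (if Y s \<in> Vfib \<and> Y t \<in> Vfib then 1 else 0)
     (pd (Ys (dual s)) (pd (Ys (dual t)) TT))"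
  unfolding deg_le_def
proof (intro allI impI)
  fix \<mu>
  assume "coef (pd (Ys (dual s)) (pd (Ys (dual t)) TT)) \<mu> \<noteq> 0"
  \<comment> \<open>The second increment reads the exponent after the first, so that
    \<open>s = t\<close> raises it twice.\<close>
  then have "coef TT (\<mu>(Ys (dual s) := Suc (\<mu> (Ys (dual s))),
      Ys (dual t) := Suc ((\<mu>(Ys (dual s) := Suc (\<mu> (Ys (dual s))))) (Ys (dual t))))) \<noteq> 0"
    (is "coef TT ?\<nu> \<noteq> 0") by (auto simp: pd_def)
  then obtain ks l l' where \<nu>: "count_list (map Y ks @ [Ys l, Ys l']) = ?\<nu>"
    and T: "T_integral ks l l' \<noteq> 0" by (rule coef_TT_nonzero)
  have \<mu>: "\<mu> (Y K200) = count_list ks K200"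
    using fun_cong [OF \<nu>, of "Y K200"] unfolding count_list_map_Y by simp
  have "?\<nu> (Ys (dual s)) \<noteq> 0" "?\<nu> (Ys (dual t)) \<noteq> 0" by simp_all
  then have st: "dual s \<in> {l, l'}" "dual t \<in> {l, l'}"
    unfolding \<nu> [symmetric] count_list_map_Ys by (auto split: if_splits)
  show "int (\<Sum>v\<in>V200. \<mu> v) \<le> (if Y s \<in> Vfib \<and> Y t \<in> Vfib then 1 else 0)"
  proof (cases "K200 \<in> set ks")
    case True
    from T_integral_nonzero(2) [OF T this] st
    have "dual s \<in> {K000, K010, K001, K011}" "dual t \<in> {K000, K010, K001, K011}" by auto
    then have "Y s \<in> Vfib \<and> Y t \<in> Vfib"
      by (cases s; cases t) (simp_all add: Vfib_def)
    then show ?thesis using T_integral_nonzero(1) [OF T] by (simp add: V200_def \<mu>)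
  next
    case False
    then show ?thesis by (simp add: V200_def \<mu>)
  qed
qed

lemma deg_le_E: "deg_le Vfib 0 (E d)" and deg_le_E_inv: "deg_le Vfib 0 (E_inv d)"
  unfolding E_def E_inv_def by (rule deg_le_exp_lin, auto simp: Vfib_def)+

text \<open>Every variable in \<open>Vfib\<close> has weight at least 1, so the total weight bounds
  their joint degree.\<close>

lemma deg_le_potential:
  assumes "0 < d"
  shows "deg_le Vfib (3 * int d - 1) (potential c d)"
  unfolding deg_le_def
proof (intro allI impI)
  fix \<mu> assume "coef (potential c d) \<mu> \<noteq> 0"
  then have "weight (\<mu> \<circ> Y) = 3 * d - 1"
    by (auto simp: potential_def split: if_splits)
  moreover have "(\<Sum>v\<in>Vfib. \<mu> v) \<le> weight (\<mu> \<circ> Y)"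
    by (simp add: Vfib_def weight_def big_def)
  ultimately show "int (\<Sum>v\<in>Vfib. \<mu> v) \<le> 3 * int d - 1"
    using assms by linarith
qed

section \<open>Degree bounds for the bilinear terms\<close>

definition coupling :: "var series \<Rightarrow> nat \<Rightarrow> var series \<Rightarrow> nat \<Rightarrow> idx \<Rightarrow> idx \<Rightarrow> var series" where
  "coupling f d1 g d2 s t =
     pd (Y s) (f * E d1) * pd (Ys (dual s)) (pd (Ys (dual t)) TT) * pd (Y t) (g * E d2)"

text \<open>Telescoping by bilinearity: one factor changes at a time.\<close>

lemma coupling_diff:
  "coupling f d1 g d2 s t - coupling f' d1 g' d2 s t
     = coupling (f - f') d1 g d2 s t + coupling f' d1 (g - g') d2 s t"
  by (simp add: coupling_def left_diff_distrib pd_diff algebra_simps)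

lemma deg_le_mult_E: "deg_le Vfib k f \<Longrightarrow> deg_le Vfib k (f * E d)"
  using deg_le_mult [OF _ deg_le_E] by fastforce

lemma deg_le_V200_mult_E: "deg_le V200 k f \<Longrightarrow> deg_le V200 k (f * E d)"
  using deg_le_mult [OF _ deg_le_subset [OF deg_le_E V200_subset]] by fastforce

text \<open>The derivative of \<open>TT\<close> adds degree 1 only if \<open>Y s\<close> and
  \<open>Y t\<close> are both in \<open>Vfib\<close>; then \<open>pd v\<close> lowers the
  \<open>Vfib\<close> degree of the other factor by 1, and the two effects cancel.\<close>

lemma deg_le_pd_TT_mult:
  assumes "deg_le Vfib k f" "v = Y s \<or> v = Y t"
  shows "deg_le V200 k (pd (Ys (dual s)) (pd (Ys (dual t)) TT) * pd v (f * E d))"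
proof (cases "Y s \<in> Vfib \<and> Y t \<in> Vfib")
  case True
  with assms have "deg_le Vfib (k - 1) (pd v (f * E d))"
    by (blast intro: deg_le_pd_in deg_le_mult_E)
  from deg_le_mult [OF deg_le_pd_TT [of s t] deg_le_subset [OF this V200_subset]] True
  show ?thesis by simp
next
  case False
  from assms have "deg_le Vfib k (pd v (f * E d))"
    by (blast intro: deg_le_pd_weak deg_le_mult_E)
  from deg_le_mult [OF deg_le_pd_TT [of s t] deg_le_subset [OF this V200_subset]] False
  show ?thesis by auto
qed

text \<open>For \<open>f\<close> only the degree in \<open>Y K200\<close> is bounded, and
  \<open>pd (Y s)\<close> need not lower it. The possible gain from \<open>TT\<close> is therefore
  charged to \<open>g\<close>, which has a \<open>Vfib\<close> bound.\<close>

lemma deg_le_coupling_left: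
  assumes "deg_le V200 k f" "deg_le Vfib l g"
  shows "deg_le V200 (k + l) (coupling f d1 g d2 s t)"
  unfolding coupling_def mult.assoc
  by (intro deg_le_mult deg_le_pd_weak deg_le_V200_mult_E deg_le_pd_TT_mult assms) simp

lemma deg_le_coupling_right:
  assumes "deg_le Vfib k f" "deg_le V200 l g"
  shows "deg_le V200 (k + l) (coupling f d1 g d2 s t)"
  unfolding coupling_def mult.commute [of "pd (Y s) _"]
  by (intro deg_le_mult deg_le_pd_weak deg_le_V200_mult_E deg_le_pd_TT_mult assms) simp

lemma deg_le_coupling_diff:
  assumes "deg_le V200 (k - 3) (f - f')" "deg_le Vfib k f'"
    and "deg_le V200 (l - 3) (g - g')" "deg_le Vfib l g"
  shows "deg_le V200 (k + l - 3) (coupling f d1 g d2 s t - coupling f' d1 g' d2 s t)"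
  unfolding coupling_diff
  using deg_le_coupling_left [OF assms(1,4)] deg_le_coupling_right [OF assms(2,3)]
  by (intro deg_le_add) (simp_all add: algebra_simps)

section \<open>The recursion and the induction on the degree\<close>

lemma satisfies_equation_coupling:
  "satisfies_equation N d \<longleftrightarrow>
     (pd (Y K200) ^^ 3) (N d) =
       of_nat 18 * (E_inv d *
       (\<Sum>(d1, d2) \<in> {(d1, d2). d1 + d2 = d \<and> d1 > 0 \<and> d2 > 0}. \<Sum>s\<in>UNIV. \<Sum>t\<in>UNIV.
          of_nat (d1 * d2) * coupling (pd (Y K200) (N d1)) d1 (pd (Y K200) (N d2)) d2 s t
          - of_nat (d1\<^sup>2) * coupling (N d1) d1 (pd (Y K200) (pd (Y K200) (N d2))) d2 s t))"
  unfolding satisfies_equation_def coupling_def by (simp add: mult.assoc)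

text \<open>Strong induction on \<open>d\<close>. In both kinds of terms the degree bounds of the
  factors sum to 3 d - 4, as (3 d1 - 2) + (3 d2 - 2) or (3 d1 - 1) + (3 d2 - 3). The inductive
  deficit of 3 gives 3 d - 7, and undoing three derivatives restores 3 d - 4.\<close>

lemma deg_le_potential_diff:
  assumes eq: "\<And>d. 2 \<le> d \<Longrightarrow> satisfies_equation (potential c) d"
    and eq': "\<And>d. 2 \<le> d \<Longrightarrow> satisfies_equation (potential c') d"
    and base: "potential c 1 = potential c' 1"
    and "0 < d"
  shows "deg_le V200 (3 * int d - 4) (potential c d - potential c' d)"
  using \<open>0 < d\<close>
proof (induction d rule: less_induct)
  case (less d)
  show ?case
  proof (cases "d = 1")
    case True
    \<comment> \<open>The difference is 0, which satisfies even the negative bound 3 - 4.\<close>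
    then show ?thesis by (simp add: base [simplified])
  next
    case False
    with less.prems have d: "2 \<le> d" by simp
    define N N' where "N = potential c" and "N' = potential c'"
    let ?D = "{(d1, d2). d1 + d2 = d \<and> d1 > 0 \<and> d2 > 0}"
    let ?p = "pd (Y K200)"
    define F where "F M d1 d2 s t =
        of_nat (d1 * d2) * coupling (?p (M d1)) d1 (?p (M d2)) d2 s t
        - of_nat (d1\<^sup>2) * coupling (M d1) d1 (?p (?p (M d2))) d2 s t"
      for M :: "nat \<Rightarrow> var series" and d1 d2 s t
    have dec: "deg_le V200 (k - 1) (?p f)" if "deg_le V200 k f" for k f
      using that by (rule deg_le_pd_in) (simp add: V200_def)
    have dec': "deg_le Vfib (k - 1) (?p f)" if "deg_le Vfib k f" for k f
      using that by (rule deg_le_pd_in) (simp add: Vfib_def)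
    have F: "deg_le V200 (3 * int d - 7) (F N d1 d2 s t - F N' d1 d2 s t)"
      if "(d1, d2) \<in> ?D" for d1 d2 s t
    proof -
      from that have dd: "d1 < d" "d2 < d" "0 < d1" "0 < d2" "int d = int d1 + int d2" by auto
      have N: "deg_le Vfib (3 * int e - 1) (N e)" "deg_le Vfib (3 * int e - 1) (N' e)"
        if "0 < e" for e
        unfolding N_def N'_def using that by (rule deg_le_potential)+
      have D: "deg_le V200 (3 * int e - 1 - 3) (N e - N' e)" if "0 < e" "e < d" for e
        unfolding N_def N'_def using less.IH [OF that(2,1)] by simp
      have D1: "deg_le V200 (3 * int e - 2 - 3) (?p (N e) - ?p (N' e))" if "0 < e" "e < d" for e
        using dec [OF D [OF that]] by (simp add: pd_diff)
      have D2: "deg_le V200 (3 * int e - 3 - 3) (?p (?p (N e)) - ?p (?p (N' e)))"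
        if "0 < e" "e < d" for e
        using dec [OF D1 [OF that]] by (simp add: pd_diff)
      have N1: "deg_le Vfib (3 * int e - 2) (?p (N e))" "deg_le Vfib (3 * int e - 2) (?p (N' e))"
        if "0 < e" for e
        using dec' [OF N(1) [OF that]] dec' [OF N(2) [OF that]] by simp_all
      have N2: "deg_le Vfib (3 * int e - 3) (?p (?p (N e)))" if "0 < e" for e
        using dec' [OF N1(1) [OF that]] by simp
      have eqF: "F N d1 d2 s t - F N' d1 d2 s t =
          of_nat (d1 * d2) * (coupling (?p (N d1)) d1 (?p (N d2)) d2 s t
            - coupling (?p (N' d1)) d1 (?p (N' d2)) d2 s t)
          - of_nat (d1\<^sup>2) * (coupling (N d1) d1 (?p (?p (N d2))) d2 s t
            - coupling (N' d1) d1 (?p (?p (N' d2))) d2 s t)"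
        unfolding F_def right_diff_distrib by (simp only: algebra_simps)
      have "deg_le V200 (3 * int d - 7) (coupling (?p (N d1)) d1 (?p (N d2)) d2 s t
            - coupling (?p (N' d1)) d1 (?p (N' d2)) d2 s t)"
        using deg_le_coupling_diff [OF D1 [OF dd(3,1)] N1(2) [OF dd(3)] D1 [OF dd(4,2)] N1(1) [OF dd(4)]]
        by (rule deg_le_mono) (simp add: dd(5))
      moreover have "deg_le V200 (3 * int d - 7) (coupling (N d1) d1 (?p (?p (N d2))) d2 s t
            - coupling (N' d1) d1 (?p (?p (N' d2))) d2 s t)"
        using deg_le_coupling_diff [OF D [OF dd(3,1)] N(2) [OF dd(3)] D2 [OF dd(4,2)] N2 [OF dd(4)]]
        by (rule deg_le_mono) (simp add: dd(5))
      ultimately show ?thesis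
        unfolding eqF by (intro deg_le_diff [OF deg_le_of_nat_mult deg_le_of_nat_mult])
    qed
    have diff: "(?p ^^ 3) (N d - N' d) =
        of_nat 18 * (E_inv d * (\<Sum>(d1, d2)\<in>?D. \<Sum>s\<in>UNIV. \<Sum>t\<in>UNIV. F N d1 d2 s t - F N' d1 d2 s t))"
    proof -
      have "(?p ^^ 3) (N d) = of_nat 18 * (E_inv d * (\<Sum>(d1, d2)\<in>?D. \<Sum>s\<in>UNIV. \<Sum>t\<in>UNIV. F N d1 d2 s t))"
        using eq [OF d] unfolding satisfies_equation_coupling N_def F_def .
      moreover have "(?p ^^ 3) (N' d) = of_nat 18 * (E_inv d * (\<Sum>(d1, d2)\<in>?D. \<Sum>s\<in>UNIV. \<Sum>t\<in>UNIV. F N' d1 d2 s t))"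
        using eq' [OF d] unfolding satisfies_equation_coupling N'_def F_def .
      ultimately show ?thesis
        by (simp only: pd_pow_diff right_diff_distrib sum_subtractf case_prod_unfold)
    qed
    have bound: "deg_le V200 (0 + (3 * int d - 7))
        (E_inv d * (\<Sum>(d1, d2)\<in>?D. \<Sum>s\<in>UNIV. \<Sum>t\<in>UNIV. F N d1 d2 s t - F N' d1 d2 s t))"
      by (intro deg_le_mult deg_le_subset [OF deg_le_E_inv V200_subset] deg_le_sum)
        (auto intro!: deg_le_sum F)
    have "deg_le V200 (0 + (3 * int d - 7)) ((?p ^^ 3) (N d - N' d))"
      unfolding diff by (rule deg_le_of_nat_mult [OF bound])
    moreover have "(?p ^^ 3) (N d - N' d) = ?p (?p (?p (N d - N' d)))"
      by (simp add: numeral_3_eq_3)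
    ultimately have "deg_le V200 (3 * int d - 4 - 1 - 1 - 1) (?p (?p (?p (N d - N' d))))"
      by simp
    then show ?thesis
      unfolding V200_def N_def [symmetric] N'_def [symmetric]
      \<comment> \<open>The bounds 3 d - 4, 3 d - 5 and 3 d - 6 must be nonnegative; the last one
        needs \<open>2 \<le> d\<close>.\<close>
      by (rule deg_le_pd_cancel [OF deg_le_pd_cancel [OF deg_le_pd_cancel]]) (use d in simp_all)
  qed
qed

lemma pd_pow_potential_unique:
  assumes "\<And>d. 2 \<le> d \<Longrightarrow> satisfies_equation (potential c) d"
    and "\<And>d. 2 \<le> d \<Longrightarrow> satisfies_equation (potential c') d"
    and "potential c 1 = potential c' 1"
    and "0 < d"
  shows "(pd (Y K200) ^^ (3 * d - 3)) (potential c d) = (pd (Y K200) ^^ (3 * d - 3)) (potential c' d)"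
proof -
  have "deg_le V200 (3 * int d - 4) (potential c d - potential c' d)"
    using assms by (rule deg_le_potential_diff)
  \<comment> \<open>Since (3 d - 4) - (3 d - 3) = -1, the differentiated difference vanishes;
    \<open>0 < d\<close> makes the truncated subtraction exact.\<close>
  from deg_le_pd_pow [OF this, of "Y K200" "3 * d - 3"] \<open>0 < d\<close>
  have "deg_le V200 (- 1) ((pd (Y K200) ^^ (3 * d - 3)) (potential c d - potential c' d))"
    by (simp add: V200_def)
  then show ?thesis
    using deg_le_neg_imp_zero by (fastforce simp: pd_pow_diff)
qed

theorem theorem7p3:
  shows "(\<forall>c c' :: nat \<Rightarrow> (idx \<Rightarrow> nat) \<Rightarrow> real.
            (\<forall>d\<ge>2. satisfies_equation (potential c) d) \<longrightarrow>
            (\<forall>d\<ge>2. satisfies_equation (potential c') d) \<longrightarrow>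
            potential c 1 = potential c' 1 \<longrightarrow>
            (\<forall>d>0. (pd (Y K200) ^^ (3 * d - 3)) (potential c d)
                 = (pd (Y K200) ^^ (3 * d - 3)) (potential c' d)))
       \<and> ((\<forall>d\<ge>2. satisfies_equation (potential N_number) d) \<longrightarrow>
            (\<forall>c :: nat \<Rightarrow> (idx \<Rightarrow> nat) \<Rightarrow> real.
               (\<forall>d\<ge>2. satisfies_equation (potential c) d) \<longrightarrow>
               potential c 1 = potential N_number 1 \<longrightarrow>
               (\<forall>d>0. (pd (Y K200) ^^ (3 * d - 3)) (potential c d)
                    = (pd (Y K200) ^^ (3 * d - 3)) (potential N_number d))))"
  \<comment> \<open>The second conjunct takes \<open>N_number\<close> for \<open>c'\<close>.\<close>
  by (intro conjI allI impI; rule pd_pow_potential_unique) blast+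

end
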